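(* Consider the SCAD estimator $\hat\theta_{SCAD}$ with $\eta_n\to0$ and $n^{1/2}\eta_n\to e$, $0\le e<\infty$. Suppose the true parameters $\theta_n\in\mathbb{R}$ satisfy $n^{1/2}\theta_n\to\nu\in\mathbb{R}\cup\{-\infty,\infty\}$. Then $F_{SCAD,n,\theta_n}$ converges weakly to the distribution given by $$\begin{aligned} &\{\Phi(-\nu+e)-\Phi(-\nu-e)\}\,d\delta_{-\nu}(x)\\ &+\Big\{\phi(x+e)\,\boldsymbol{1}(0<x+\nu\le e)+\phi(x-e)\,\boldsymbol{1}(-e\le x+\nu<0)\\ &\quad+\frac{a-2}{a-1}\,\phi\big(\{(a-2)x-\nu+ae\}/(a-1)\big)\,\boldsymbol{1}(e<x+\nu\le ae)\\ &\quad+\frac{a-2}{a-1}\,\phi\big(\{(a-2)x-\nu-ae\}/(a-1)\big)\,\boldsymbol{1}(-ae\le x+\nu<-e)\\ &\quad+\phi(x)\,\boldsymbol{1}(|x+\nu|>ae)\Big\}\,dx. \end{aligned}$$ [This limit reduces to the standard normal distribution in case $|\nu|=\infty$ or $e=0$.]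
   Context: For each $n\ge1$ and $\theta\in\mathbb{R}$, $P_{n,\theta}$ is the probability measure under which $y_1,\dots,y_n$ are independent and each $N(\theta,1)$-distributed; $\bar y=n^{-1}\sum_{t=1}^n y_t$. $(\eta_n)$ is a sequence of positive real numbers and $a>2$ is a fixed constant. The SCAD estimator is $\hat\theta_{SCAD}=\mathrm{sign}(\bar y)(|\bar y|-\eta_n)_+$ if $|\bar y|\le 2\eta_n$, $\hat\theta_{SCAD}=\{(a-1)\bar y-\mathrm{sign}(\bar y)a\eta_n\}/(a-2)$ if $2\eta_n<|\bar y|\le a\eta_n$, and $\hat\theta_{SCAD}=\bar y$ if $|\bar y|>a\eta_n$, where $z_+=\max\{z,0\}$ and $\mathrm{sign}(x)=-1,0,1$ for $x<0$, $x=0$, $x>0$. $F_{SCAD,n,\theta}$ denotes the distribution (and its cdf) of $n^{1/2}(\hat\theta_{SCAD}-\theta)$ under $P_{n,\theta}$. $\Phi$ and $\phi$ are the standard normal cdf and density, $\Phi(-\infty)=0$, $\Phi(\infty)=1$; $\delta_z$ is pointmass at $z$; $\boldsymbol{1}(\cdot)$ is the indicator function. When $|\nu|=\infty$ the coefficient of the atomic part is $0$, so that part is absent, and all indicator terms vanish except the last, which equals $1$. *)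

theory Defs
  imports "HOL-Probability.Probability"
begin

definition sample_measure :: "nat \<Rightarrow> real \<Rightarrow> (nat \<Rightarrow> real) measure" where
  "sample_measure n \<theta> = (\<Pi>\<^sub>M t\<in>{1..n}. density lborel (normal_density \<theta> 1))"

definition sample_mean :: "nat \<Rightarrow> (nat \<Rightarrow> real) \<Rightarrow> real" where
  "sample_mean n y = (\<Sum>t=1..n. y t) / real n"

definition scad_threshold :: "real \<Rightarrow> real \<Rightarrow> real \<Rightarrow> real" where
  "scad_threshold a \<eta> m =
    (if \<bar>m\<bar> \<le> 2 * \<eta> then sgn m * max (\<bar>m\<bar> - \<eta>) 0
     else if \<bar>m\<bar> \<le> a * \<eta> then ((a - 1) * m - sgn m * a * \<eta>) / (a - 2)
     else m)"

definition scad_estimator :: "real \<Rightarrow> real \<Rightarrow> nat \<Rightarrow> (nat \<Rightarrow> real) \<Rightarrow> real" where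
  "scad_estimator a \<eta> n y = scad_threshold a \<eta> (sample_mean n y)"

definition scad_distribution :: "real \<Rightarrow> real \<Rightarrow> nat \<Rightarrow> real \<Rightarrow> real measure" where
  "scad_distribution a \<eta> n \<theta> =
    distr (sample_measure n \<theta>) borel (\<lambda>y. sqrt (real n) * (scad_estimator a \<eta> n y - \<theta>))"

definition std_normal_cdf :: "ereal \<Rightarrow> real" where
  "std_normal_cdf z =
    (case z of ereal r \<Rightarrow> cdf std_normal_distribution r | PInfty \<Rightarrow> 1 | MInfty \<Rightarrow> 0)"

definition add_measure :: "'a measure \<Rightarrow> 'a measure \<Rightarrow> 'a measure" where
  "add_measure M N = measure_of (space M) (sets M) (\<lambda>A. emeasure M A + emeasure N A)"

lemma space_add_measure [simp]: "space (add_measure M N) = space M"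
  by (simp add: add_measure_def)

lemma sets_add_measure [simp, measurable_cong]: "sets (add_measure M N) = sets M"
  by (simp add: add_measure_def)

lemma emeasure_add_measure:
  assumes "sets N = sets M" and "A \<in> sets M"
  shows "emeasure (add_measure M N) A = emeasure M A + emeasure N A"
proof (rule emeasure_measure_of[OF add_measure_def])
  show "sets M \<subseteq> Pow (space M)"
    by (rule sets.space_closed)
  show "A \<in> sets (add_measure M N)"
    using assms(2) by simp
  show "positive (sets (add_measure M N)) (\<lambda>A. emeasure M A + emeasure N A)"
    by (simp add: positive_def)
  show "countably_additive (sets (add_measure M N)) (\<lambda>A. emeasure M A + emeasure N A)"
  proof (rule countably_additiveI)
    fix B :: "nat \<Rightarrow> 'a set"
    assume "range B \<subseteq> sets (add_measure M N)" "disjoint_family B"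
    then have "range B \<subseteq> sets M" "range B \<subseteq> sets N" "disjoint_family B"
      using assms(1) by auto
    then show "(\<Sum>i. emeasure M (B i) + emeasure N (B i))
        = emeasure M (\<Union>i. B i) + emeasure N (\<Union>i. B i)"
      by (simp add: suminf_add[symmetric] suminf_emeasure)
  qed
qed

text \<open>
  For infinite \<open>\<nu>\<close> the value \<^term>\<open>real_of_ereal \<nu> = 0\<close> is a dummy: every term containing it then
  has a vanishing indicator or, for the atom in \<open>scad_limit\<close>, the coefficient \<open>0\<close>.
\<close>

definition scad_limit_density :: "real \<Rightarrow> real \<Rightarrow> ereal \<Rightarrow> real \<Rightarrow> real" where
  "scad_limit_density a e \<nu> x =
     std_normal_density (x + e) * of_bool (0 < ereal x + \<nu> \<and> ereal x + \<nu> \<le> ereal e)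
   + std_normal_density (x - e) * of_bool (ereal (- e) \<le> ereal x + \<nu> \<and> ereal x + \<nu> < 0)
   + (a - 2) / (a - 1) * std_normal_density (((a - 2) * x - real_of_ereal \<nu> + a * e) / (a - 1))
       * of_bool (ereal e < ereal x + \<nu> \<and> ereal x + \<nu> \<le> ereal (a * e))
   + (a - 2) / (a - 1) * std_normal_density (((a - 2) * x - real_of_ereal \<nu> - a * e) / (a - 1))
       * of_bool (ereal (- (a * e)) \<le> ereal x + \<nu> \<and> ereal x + \<nu> < ereal (- e))
   + std_normal_density x * of_bool (\<bar>ereal x + \<nu>\<bar> > ereal (a * e))"

definition scad_limit :: "real \<Rightarrow> real \<Rightarrow> ereal \<Rightarrow> real measure" where
  "scad_limit a e \<nu> =
    add_measure
      (scale_measure (ennreal (std_normal_cdf (- \<nu> + ereal e) - std_normal_cdf (- \<nu> - ereal e)))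
        (return borel (- real_of_ereal \<nu>)))
      (density lborel (\<lambda>x. ennreal (scad_limit_density a e \<nu> x)))"

end

theory Submission
  imports Defs
begin

text \<open>
  Writing \<open>Z\<close> for the standardised sample mean, homogeneity of the threshold map \<open>T\<close> shows that
  the rescaled estimator is \<open>T (sqrt n \<eta>) (Z + sqrt n \<theta>) - sqrt n \<theta>\<close>, where the law of \<open>Z\<close> is the
  same for all \<open>n\<close>. As \<open>T\<close> is jointly continuous and the identity far from the origin, these
  functions of \<open>Z\<close> converge pointwise, hence in law, to \<open>T e (Z + \<nu>) - \<nu>\<close>, or to \<open>Z\<close> if \<open>\<nu>\<close> is
  infinite. The limit map is piecewise affine: it is constant where \<open>\<bar>Z + \<nu>\<bar> \<le> e\<close>, which gives the
  atom, and a linear substitution on each other piece gives the corresponding density term.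
\<close>

section \<open>Weak convergence from pointwise convergence\<close>

text \<open>Dominated convergence applies to every continuous test function bounded by 1: the
  constant 1 is an integrable bound on a probability space.\<close>

lemma weak_conv_m_distr_pointwise:
  fixes X :: "nat \<Rightarrow> 'a \<Rightarrow> real"
  assumes "prob_space M"
    and X [measurable]: "\<And>n. X n \<in> borel_measurable M"
    and Y [measurable]: "Y \<in> borel_measurable M"
    and lim: "\<And>x. x \<in> space M \<Longrightarrow> (\<lambda>n. X n x) \<longlonglongrightarrow> Y x"
  shows "weak_conv_m (\<lambda>n. distr M borel (X n)) (distr M borel Y)"
proof -
  interpret prob_space M by fact
  show ?thesis
  proof (rule integral_bdd_continuous_conv_imp_weak_conv)
    fix f :: "real \<Rightarrow> real"
    assume f: "\<And>x. isCont f x" "\<And>x. \<bar>f x\<bar> \<le> 1"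
    have [measurable]: "f \<in> borel_measurable borel"
      using f(1) by (intro borel_measurable_continuous_onI continuous_at_imp_continuous_on) auto
    have "(\<lambda>n. \<integral>x. f (X n x) \<partial>M) \<longlonglongrightarrow> (\<integral>x. f (Y x) \<partial>M)"
      by (rule integral_dominated_convergence[where w = "\<lambda>_. 1"])
        (use f lim in \<open>auto intro!: AE_I2 isCont_tendsto_compose[of _ f]\<close>)
    then show "(\<lambda>n. integral\<^sup>L (distr M borel (X n)) f) \<longlonglongrightarrow> integral\<^sup>L (distr M borel Y) f"
      by (simp add: integral_distr)
  qed auto
qed

section \<open>The threshold map: joint continuity and homogeneity\<close>

text \<open>The threshold map is odd, and \<open>S\<close> is its positive half. The interpolating
  line has slope \<open>(a - 1) / (a - 2) > 1\<close>; it meets \<open>m - \<eta>\<close> at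
  \<open>2 * \<eta>\<close> and \<open>m\<close> at \<open>a * \<eta>\<close>, so \<open>max\<close>
  and \<open>min\<close> select the correct branch. Continuity in both arguments, also at
  \<open>\<eta> = 0\<close>, can then be read off.\<close>

lemma scad_threshold_eq_max_min:
  assumes "a > 2" and "\<eta> \<ge> 0"
  defines "S \<equiv> \<lambda>m. max (max (m - \<eta>) 0) (min m (((a - 1) * m - a * \<eta>) / (a - 2)))"
  shows "scad_threshold a \<eta> m = S m - S (- m)"
proof -
  have neg: "S u = 0" if "u \<le> 0" for u
    using that assms by (auto simp: S_def max_def min_def)
  have pos: "S u = (if u \<le> 2 * \<eta> then max (u - \<eta>) 0
      else if u \<le> a * \<eta> then ((a - 1) * u - a * \<eta>) / (a - 2) else u)" if "u > 0" for u
  proof -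
    define L where "L = ((a - 1) * u - a * \<eta>) / (a - 2)"
    have "L \<le> u - \<eta> \<longleftrightarrow> u \<le> 2 * \<eta>" "L \<le> u \<longleftrightarrow> u \<le> a * \<eta>"
      unfolding L_def using assms(1) by (subst pos_divide_le_eq; simp add: algebra_simps)+
    moreover have "2 * \<eta> \<le> a * \<eta>"
      using assms by (intro mult_right_mono) auto
    ultimately show ?thesis
      using that assms(2) unfolding S_def L_def[symmetric] max_def min_def
      by (auto split: if_splits simp del: mult_le_cancel_right)
  qed
  consider "m > 0" | "m = 0" | "m < 0" by linarith
  then show ?thesis
  proof cases
    case 1
    then show ?thesis
      using neg[of "- m"] pos[of m] by (simp add: scad_threshold_def)
  next
    case 2
    then show ?thesis using assms by (simp add: scad_threshold_def)
  next
    case 3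
    have "((a - 1) * m + a * \<eta>) / (a - 2) = - (((a - 1) * (- m) - a * \<eta>) / (a - 2))"
      unfolding minus_divide_left by simp
    then show ?thesis
      using 3 neg[of m] pos[of "- m"] by (simp add: scad_threshold_def)
  qed
qed

lemma tendsto_scad_threshold:
  assumes "a > 2" and "0 \<le> e" and "\<forall>\<^sub>F x in F. 0 \<le> f x"
    and lim: "(f \<longlongrightarrow> e) F" "(g \<longlongrightarrow> m) F"
  shows "((\<lambda>x. scad_threshold a (f x) (g x)) \<longlongrightarrow> scad_threshold a e m) F"
proof -
  define S where
    "S = (\<lambda>\<eta> m. max (max (m - \<eta>) 0) (min m (((a - 1) * m - a * \<eta>) / (a - 2))))"
  have "((\<lambda>x. S (f x) (g x) - S (f x) (- g x)) \<longlongrightarrow> S e m - S e (- m)) F"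
    unfolding S_def using \<open>a > 2\<close>
    by (intro tendsto_intros lim tendsto_max tendsto_min) auto
  moreover have "\<forall>\<^sub>F x in F. S (f x) (g x) - S (f x) (- g x) = scad_threshold a (f x) (g x)"
    using assms(3) by eventually_elim (use \<open>a > 2\<close> in \<open>simp add: scad_threshold_eq_max_min S_def\<close>)
  moreover have "S e m - S e (- m) = scad_threshold a e m"
    using assms(1,2) by (simp add: scad_threshold_eq_max_min S_def)
  ultimately show ?thesis
    by (auto intro: Lim_transform_eventually)
qed

lemma measurable_scad_threshold [measurable]: "scad_threshold a \<eta> \<in> borel_measurable borel"
  unfolding scad_threshold_def[abs_def] sgn_if by measurable

text \<open>The breakpoints are multiples of \<open>\<eta>\<close> and each branch is linear in
  \<open>(\<eta>, m)\<close> for a fixed sign of \<open>m\<close>. This moves the factor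
  \<open>sqrt n\<close> inside the estimator.\<close>

lemma scad_threshold_scale:
  assumes "c > 0"
  shows "scad_threshold a (c * \<eta>) (c * m) = c * scad_threshold a \<eta> m"
proof -
  have "\<bar>c * m\<bar> \<le> 2 * (c * \<eta>) \<longleftrightarrow> \<bar>m\<bar> \<le> 2 * \<eta>" "\<bar>c * m\<bar> \<le> a * (c * \<eta>) \<longleftrightarrow> \<bar>m\<bar> \<le> a * \<eta>"
    using assms mult_le_cancel_left_pos[of c "\<bar>m\<bar>"] by (auto simp: abs_mult mult.left_commute)
  moreover have "max (\<bar>c * m\<bar> - c * \<eta>) 0 = c * max (\<bar>m\<bar> - \<eta>) 0"
    using assms by (simp add: abs_mult max_mult_distrib_left right_diff_distrib)
  ultimately show ?thesis
    using assms by (simp add: scad_threshold_def sgn_mult algebra_simps)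
qed

lemma scad_threshold_zero [simp]: "scad_threshold a 0 m = m"
  by (simp add: scad_threshold_def)

lemma scad_threshold_large:
  assumes "a > 2" and "\<eta> \<ge> 0" and "\<bar>m\<bar> > a * \<eta>"
  shows "scad_threshold a \<eta> m = m"
proof -
  have "2 * \<eta> \<le> a * \<eta>"
    using assms by (intro mult_right_mono) auto
  then show ?thesis
    using assms by (simp add: scad_threshold_def)
qed

section \<open>The law of the standardised sample mean\<close>

lemma prob_space_normal_1: "prob_space (density lborel (normal_density \<theta> 1))"
  by (rule prob_space_normal_density) simp

lemma prob_space_sample_measure: "prob_space (sample_measure n \<theta>)"
  unfolding sample_measure_def by (intro prob_space_PiM prob_space_normal_1)

lemma measurable_sample_mean [measurable]: "sample_mean n \<in> borel_measurable (sample_measure n \<theta>)"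
  unfolding sample_mean_def[abs_def] sample_measure_def by measurable

lemma distributed_standardised_sample_mean:
  assumes "n \<ge> 1"
  shows "distributed (sample_measure n \<theta>) lborel
    (\<lambda>y. sqrt (real n) * (sample_mean n y - \<theta>)) std_normal_density"
proof -
  let ?N = "density lborel (normal_density \<theta> 1)"
  let ?M = "sample_measure n \<theta>"
  interpret prob_space ?M by (rule prob_space_sample_measure)
  have comp: "distr ?M borel (\<lambda>y. y t) = ?N" if "t \<in> {1..n}" for t
  proof -
    have "distr ?M borel (\<lambda>y. y t) = distr ?M ?N (\<lambda>y. y t)"
      by (rule distr_cong) auto
    also have "\<dots> = ?N"
      unfolding sample_measure_def using that
      by (intro distr_PiM_component[where M = "\<lambda>_. ?N"] prob_space_normal_1)
    finally show ?thesis .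
  qed
  have rv: "(\<lambda>y. y t) \<in> borel_measurable ?M" if "t \<in> {1..n}" for t
    unfolding sample_measure_def using that by measurable
  \<comment> \<open>Restriction to \<open>{1..n}\<close> is the identity on the product space, so
    the joint law of the coordinates is the sample measure. That this equals the product of the
    marginals characterises independence; \<open>n \<ge> 1\<close> makes the index set
    nonempty.\<close>
  have "distr ?M (\<Pi>\<^sub>M t\<in>{1..n}. borel) (\<lambda>y. \<lambda>t\<in>{1..n}. y t) = distr ?M ?M (\<lambda>y. y)"
  proof (rule distr_cong)
    show "sets (\<Pi>\<^sub>M t\<in>{1..n}. borel) = sets ?M"
      unfolding sample_measure_def by (intro sets_PiM_cong) auto
  qed (auto simp: sample_measure_def space_PiM PiE_def extensional_restrict)
  also have "\<dots> = (\<Pi>\<^sub>M t\<in>{1..n}. distr ?M borel (\<lambda>y. y t))"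
    unfolding distr_id by (rule trans[OF sample_measure_def], rule PiM_cong) (simp_all add: comp)
  finally have indep: "indep_vars (\<lambda>_. borel) (\<lambda>t y. y t) {1..n}"
    using assms rv by (subst indep_vars_iff_distr_eq_PiM') auto
  have "distributed ?M lborel (\<lambda>y. y t) (normal_density \<theta> 1)" if "t \<in> {1..n}" for t
    unfolding distributed_def using comp[OF that] rv[OF that]
    by (auto cong: distr_cong simp: distr_cong[of ?M ?M lborel borel])
  then have "distributed ?M lborel (\<lambda>y. \<Sum>t\<in>{1..n}. y t)
      (normal_density (\<Sum>t\<in>{1..n}. \<theta>) (sqrt (\<Sum>t\<in>{1..n}. 1\<^sup>2)))"
    using assms by (intro sum_indep_normal indep) auto
  then have "distributed ?M lborel (\<lambda>y. ((\<Sum>t\<in>{1..n}. y t) - real n * \<theta>) / sqrt (real n)) std_normal_density"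
    using assms by (subst (asm) normal_standard_normal_convert) auto
  moreover have "((\<Sum>t\<in>{1..n}. y t) - real n * \<theta>) / sqrt (real n)
      = sqrt (real n) * (sample_mean n y - \<theta>)" for y
    using assms by (simp add: sample_mean_def field_simps)
  ultimately show ?thesis by simp
qed

text \<open>With \<open>Z\<close> the standardised mean, \<open>sqrt n\<close> times the sample mean
  is \<open>Z + sqrt n * \<theta>\<close>. All \<open>n\<close> thereby share one probability space,
  on which pointwise limits make sense.\<close>

lemma scad_distribution_eq_distr_std_normal:
  assumes "n \<ge> 1"
  shows "scad_distribution a \<eta> n \<theta> = distr std_normal_distribution borel
    (\<lambda>z. scad_threshold a (sqrt (real n) * \<eta>) (z + sqrt (real n) * \<theta>) - sqrt (real n) * \<theta>)"
proof -
  let ?Z = "\<lambda>y. sqrt (real n) * (sample_mean n y - \<theta>)"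
  let ?G = "\<lambda>z. scad_threshold a (sqrt (real n) * \<eta>) (z + sqrt (real n) * \<theta>) - sqrt (real n) * \<theta>"
  have "std_normal_distribution = distr (sample_measure n \<theta>) lborel ?Z"
    using distributed_distr_eq_density[OF distributed_standardised_sample_mean[OF assms]] by simp
  then have "distr std_normal_distribution borel ?G
      = distr (sample_measure n \<theta>) borel (?G \<circ> ?Z)"
    by (simp add: distr_distr)
  also have "?G \<circ> ?Z = (\<lambda>y. sqrt (real n) * (scad_estimator a \<eta> n y - \<theta>))"
    using assms scad_threshold_scale[of "sqrt (real n)" a \<eta>]
    by (auto simp: scad_estimator_def algebra_simps)
  finally show ?thesis
    by (simp add: scad_distribution_def)
qed

section \<open>The limit as an image of the standard normal law\<close>

text \<open>The cdf difference measures \<open>{u<..v}\<close>, and the left endpoint is a null set.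
  Used for the mass of the atom.\<close>

lemma emeasure_std_normal_Icc:
  assumes "u \<le> v"
  shows "emeasure std_normal_distribution {u..v}
    = ennreal (cdf std_normal_distribution v - cdf std_normal_distribution u)"
proof -
  interpret real_distribution std_normal_distribution by (rule real_dist_normal_dist)
  have "emeasure std_normal_distribution {u..v} = emeasure std_normal_distribution {u<..v}"
  proof (rule emeasure_eq_AE)
    have "AE x in lborel. x \<noteq> u" by (rule AE_lborel_singleton)
    then have "AE x in std_normal_distribution. x \<noteq> u"
      by (auto simp: AE_density)
    then show "AE x in std_normal_distribution. x \<in> {u..v} \<longleftrightarrow> x \<in> {u<..v}"
      by eventually_elim auto
  qed auto
  then show ?thesis using emeasure_Ioc[OF assms] by simp
qed

text \<open>Substitution \<open>z = t + c * x\<close> on a piece \<open>I\<close> where the limit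
  map acts as the affine map \<open>g\<close>: the part of the normal law on \<open>I\<close> is
  carried to a law with an explicit density.\<close>

lemma nn_integral_std_normal_affine:
  assumes [measurable]: "A \<in> sets borel" "I \<in> sets borel" and "c > 0"
    and inv: "\<And>x. g (t + c * x) = x"
  shows "(\<integral>\<^sup>+z. ennreal (std_normal_density z) * indicator I z * indicator A (g z) \<partial>lborel)
    = (\<integral>\<^sup>+x. ennreal (c * std_normal_density (t + c * x) * of_bool (t + c * x \<in> I)) * indicator A x \<partial>lborel)"
proof -
  \<comment> \<open>As \<open>t + c * x\<close> runs through all reals, \<open>inv\<close>
    determines \<open>g\<close>; the explicit form supplies its measurability.\<close>
  have g: "g = (\<lambda>z. (z - t) / c)"
  proof
    fix z
    show "g z = (z - t) / c" using inv[of "(z - t) / c"] \<open>c > 0\<close> by simp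
  qed
  have "(\<integral>\<^sup>+z. ennreal (std_normal_density z) * indicator I z * indicator A (g z) \<partial>lborel)
    = ennreal \<bar>c\<bar> * (\<integral>\<^sup>+x. ennreal (std_normal_density (t + c * x)) * indicator I (t + c * x)
        * indicator A (g (t + c * x)) \<partial>lborel)"
    using \<open>c > 0\<close> unfolding g by (intro nn_integral_real_affine) auto
  also have "\<dots> = (\<integral>\<^sup>+x. ennreal \<bar>c\<bar> * (ennreal (std_normal_density (t + c * x)) * indicator I (t + c * x)
        * indicator A x) \<partial>lborel)"
    unfolding inv by (rule nn_integral_cmult[symmetric]) measurable
  also have "\<dots> = (\<integral>\<^sup>+x. ennreal (c * std_normal_density (t + c * x) * of_bool (t + c * x \<in> I)) * indicator A x \<partial>lborel)"
    using \<open>c > 0\<close> by (intro nn_integral_cong) (auto simp: ennreal_mult indicator_def)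
  finally show ?thesis .
qed

lemma scad_limit_eq_distr:
  fixes r :: real
  assumes "a > 2" and "0 \<le> e"
  shows "scad_limit a e (ereal r)
    = distr std_normal_distribution borel (\<lambda>z. scad_threshold a e (z + r) - r)"
proof (rule measure_eqI)
  let ?G = "\<lambda>z. scad_threshold a e (z + r) - r"
  show sets: "sets (scad_limit a e (ereal r)) = sets (distr std_normal_distribution borel ?G)"
    by (simp add: scad_limit_def)
  fix A assume "A \<in> sets (scad_limit a e (ereal r))"
  then have A [measurable]: "A \<in> sets borel" by (simp add: scad_limit_def)
  \<comment> \<open>\<open>J\<close> is the contribution of a piece \<open>I\<close> on which the
    map acts as \<open>g\<close>; \<open>D\<close> is the density into which the substitution
    \<open>z = t + c * x\<close> turns it.\<close>
  define J where "J I g z = ennreal (std_normal_density z) * indicator I z * indicator A (g z)"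
    for I and g :: "real \<Rightarrow> real" and z :: real
  define D where "D c t I x = c * std_normal_density (t + c * x) * of_bool (t + c * x \<in> I)"
    for c t :: real and I :: "real set" and x
  \<comment> \<open>The reciprocal slope of the interpolating branch, hence the Jacobian factor in
    the limit density.\<close>
  define c where "c = (a - 2) / (a - 1)"
  \<comment> \<open>The pieces partition the line at \<open>z + r\<close> equal to plus or minus
    \<open>e\<close>, \<open>2 * e\<close> and \<open>a * e\<close>: soft thresholding
    (\<open>sp\<close>, \<open>sn\<close>), interpolation (\<open>lp\<close>, \<open>ln\<close>),
    identity (\<open>ou\<close>), and the centre \<open>ce\<close> that collapses to the
    atom.\<close>
  define sp where "sp = {z. e < z + r \<and> z + r \<le> 2 * e}"
  define sn where "sn = {z. - (2 * e) \<le> z + r \<and> z + r < - e}"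
  define lp where "lp = {z. 2 * e < z + r \<and> z + r \<le> a * e}"
  define ln where "ln = {z. - (a * e) \<le> z + r \<and> z + r < - (2 * e)}"
  define ou where "ou = {z. \<bar>z + r\<bar> > a * e}"
  define ce where "ce = {- r - e..- r + e}"
  have [measurable]: "sp \<in> sets borel" "sn \<in> sets borel" "lp \<in> sets borel" "ln \<in> sets borel"
      "ou \<in> sets borel" "ce \<in> sets borel"
    unfolding sp_def sn_def lp_def ln_def ou_def ce_def by measurable
  have "c > 0" using \<open>a > 2\<close> by (simp add: c_def)
  have ae: "2 * e \<le> a * e" using assms by (intro mult_right_mono) auto
  define gp where "gp z = ((a - 1) * (z + r) - a * e) / (a - 2) - r" for z
  define gn where "gn z = ((a - 1) * (z + r) + a * e) / (a - 2) - r" for z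
  have split: "ennreal (std_normal_density z) * indicator A (?G z)
      = J ce (\<lambda>_. - r) z + J sp (\<lambda>z. z - e) z + J sn (\<lambda>z. z + e) z + J lp gp z + J ln gn z
        + J ou (\<lambda>z. z) z" for z
  proof -
    have "z \<in> ce \<or> z \<in> sp \<or> z \<in> sn \<or> z \<in> lp \<or> z \<in> ln \<or> z \<in> ou"
      unfolding sp_def sn_def lp_def ln_def ou_def ce_def mem_Collect_eq atLeastAtMost_iff
      by linarith
    then consider "z \<in> ce" | "z \<in> sp" | "z \<in> sn" | "z \<in> lp" | "z \<in> ln" | "z \<in> ou"
      by blast
    then show ?thesis
    proof cases
      case 1
      moreover have "z \<notin> sp" "z \<notin> sn" "z \<notin> lp" "z \<notin> ln" "z \<notin> ou" "\<bar>z + r\<bar> \<le> e"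
        using 1 ae assms(2) unfolding ce_def sp_def sn_def lp_def ln_def ou_def mem_Collect_eq atLeastAtMost_iff
        by linarith+
      moreover have "?G z = - r"
        using \<open>\<bar>z + r\<bar> \<le> e\<close> assms(2) by (simp add: scad_threshold_def)
      ultimately show ?thesis by (simp add: J_def)
    next
      case 2
      moreover have "z \<notin> ce" "z \<notin> sn" "z \<notin> lp" "z \<notin> ln" "z \<notin> ou" "z + r > e" "z + r \<le> 2 * e"
        using 2 ae assms(2) unfolding ce_def sp_def sn_def lp_def ln_def ou_def mem_Collect_eq atLeastAtMost_iff
        by linarith+
      moreover have "?G z = z - e"
        using \<open>z + r > e\<close> \<open>z + r \<le> 2 * e\<close> assms(2) by (simp add: scad_threshold_def)
      ultimately show ?thesis by (simp add: J_def)
    next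
      case 3
      moreover have "z \<notin> ce" "z \<notin> sp" "z \<notin> lp" "z \<notin> ln" "z \<notin> ou" "z + r < - e" "z + r \<ge> - (2 * e)"
        using 3 ae assms(2) unfolding ce_def sp_def sn_def lp_def ln_def ou_def mem_Collect_eq atLeastAtMost_iff
        by linarith+
      moreover have "?G z = z + e"
        using \<open>z + r < - e\<close> \<open>z + r \<ge> - (2 * e)\<close> assms(2) by (simp add: scad_threshold_def)
      ultimately show ?thesis by (simp add: J_def)
    next
      case 4
      moreover have "z \<notin> ce" "z \<notin> sp" "z \<notin> sn" "z \<notin> ln" "z \<notin> ou" "z + r > 2 * e" "z + r \<le> a * e"
        using 4 ae assms(2) unfolding ce_def sp_def sn_def lp_def ln_def ou_def mem_Collect_eq atLeastAtMost_iff
        by linarith+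
      moreover have "?G z = gp z"
        using \<open>z + r > 2 * e\<close> \<open>z + r \<le> a * e\<close> assms(2) by (simp add: scad_threshold_def gp_def)
      ultimately show ?thesis by (simp add: J_def)
    next
      case 5
      moreover have "z \<notin> ce" "z \<notin> sp" "z \<notin> sn" "z \<notin> lp" "z \<notin> ou" "z + r < - (2 * e)" "z + r \<ge> - (a * e)"
        using 5 ae assms(2) unfolding ce_def sp_def sn_def lp_def ln_def ou_def mem_Collect_eq atLeastAtMost_iff
        by linarith+
      moreover have "?G z = gn z"
        using \<open>z + r < - (2 * e)\<close> \<open>z + r \<ge> - (a * e)\<close> assms(2) by (simp add: scad_threshold_def gn_def)
      ultimately show ?thesis by (simp add: J_def)
    next
      case 6
      moreover have "z \<notin> ce" "z \<notin> sp" "z \<notin> sn" "z \<notin> lp" "z \<notin> ln" "\<bar>z + r\<bar> > a * e"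
        using 6 ae assms(2) unfolding ce_def sp_def sn_def lp_def ln_def ou_def mem_Collect_eq atLeastAtMost_iff
        by linarith+
      moreover have "?G z = z"
        using \<open>\<bar>z + r\<bar> > a * e\<close> assms by (simp add: scad_threshold_large)
      ultimately show ?thesis by (simp add: J_def)
    qed
  qed
  have [measurable]: "gp \<in> borel_measurable borel" "gn \<in> borel_measurable borel"
    unfolding gp_def[abs_def] gn_def[abs_def] by measurable
  have J_meas [measurable]: "J I g \<in> borel_measurable borel"
    if [measurable]: "I \<in> sets borel" "g \<in> borel_measurable borel" for I g
    unfolding J_def[abs_def] by measurable
  have D_meas [measurable]: "D k t I \<in> borel_measurable borel"
    if [measurable]: "I \<in> sets borel" for k t I
    unfolding D_def[abs_def] by measurable
  have affine: "(\<integral>\<^sup>+z. J I g z \<partial>lborel) = (\<integral>\<^sup>+x. ennreal (D k t I x) * indicator A x \<partial>lborel)"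
    if "I \<in> sets borel" "k > 0" "\<And>x. g (t + k * x) = x" for I g k t
    unfolding J_def D_def using that by (intro nn_integral_std_normal_affine) auto
  have c: "(a - 1) * (u / (a - 1) + c * x + r) = u + (a - 2) * x + (a - 1) * r" for u x
    using \<open>a > 2\<close> by (simp add: distrib_left c_def)
  have tp: "gp ((- r + a * e) / (a - 1) + c * x) = x" for x
  proof -
    have "(a - 1) * ((- r + a * e) / (a - 1) + c * x + r) = (a - 2) * (x + r) + a * e"
      unfolding c by (simp add: algebra_simps)
    then show ?thesis using \<open>a > 2\<close> by (simp add: gp_def)
  qed
  have tn: "gn ((- r - a * e) / (a - 1) + c * x) = x" for x
  proof -
    have "(a - 1) * ((- r - a * e) / (a - 1) + c * x + r) = (a - 2) * (x + r) - a * e"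
      unfolding c by (simp add: algebra_simps)
    then show ?thesis using \<open>a > 2\<close> by (simp add: gn_def)
  qed
  \<comment> \<open>The substitutions pull the pieces back to the indicator ranges of the limit
    density: in terms of \<open>x + r\<close>, \<open>sp\<close> becomes the range from
    \<open>0\<close> to \<open>e\<close>, and \<open>lp\<close> the range from \<open>e\<close> to
    \<open>a * e\<close>.\<close>
  have dens: "scad_limit_density a e (ereal r) x
      = D 1 e sp x + D 1 (- e) sn x + D c ((- r + a * e) / (a - 1)) lp x
        + D c ((- r - a * e) / (a - 1)) ln x + D 1 0 ou x" for x
  proof -
    have z: "((- r + a * e) / (a - 1) + c * x) = ((a - 2) * x - r + a * e) / (a - 1)"
        "((- r - a * e) / (a - 1) + c * x) = ((a - 2) * x - r - a * e) / (a - 1)"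
      by (simp_all add: c_def divide_inverse algebra_simps)
    have "((a - 2) * x - r + a * e) / (a - 1) + r = ((a - 2) * (x + r) + a * e) / (a - 1)"
        "((a - 2) * x - r - a * e) / (a - 1) + r = ((a - 2) * (x + r) - a * e) / (a - 1)"
      using \<open>a > 2\<close> by (simp_all add: field_simps)
    \<comment> \<open>Clearing the denominator leaves a common factor \<open>a - 2\<close>, as in
      \<open>2 * e * (a - 1) - a * e = (a - 2) * e\<close>; it is cancelled in the next
      step.\<close>
    moreover have "2 * e < ((a - 2) * (x + r) + a * e) / (a - 1) \<longleftrightarrow> (a - 2) * e < (a - 2) * (x + r)"
        "((a - 2) * (x + r) + a * e) / (a - 1) \<le> a * e \<longleftrightarrow> (a - 2) * (x + r) \<le> (a - 2) * (a * e)"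
        "((a - 2) * (x + r) - a * e) / (a - 1) < - (2 * e) \<longleftrightarrow> (a - 2) * (x + r) < (a - 2) * (- e)"
        "- (a * e) \<le> ((a - 2) * (x + r) - a * e) / (a - 1) \<longleftrightarrow> (a - 2) * (- (a * e)) \<le> (a - 2) * (x + r)"
      using \<open>a > 2\<close> by (simp_all add: pos_less_divide_eq pos_divide_le_eq pos_divide_less_eq
          pos_le_divide_eq algebra_simps)
    ultimately have
        lp: "((a - 2) * x - r + a * e) / (a - 1) \<in> lp \<longleftrightarrow> e < x + r \<and> x + r \<le> a * e" and
        ln: "((a - 2) * x - r - a * e) / (a - 1) \<in> ln \<longleftrightarrow> - (a * e) \<le> x + r \<and> x + r < - e"
      using \<open>a > 2\<close> unfolding lp_def ln_def mem_Collect_eq by (simp_all only: mult_less_cancel_left_pos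
          mult_le_cancel_left_pos diff_gt_0_iff_gt)
    have sp: "e + x \<in> sp \<longleftrightarrow> 0 < x + r \<and> x + r \<le> e"
      and sn: "x - e \<in> sn \<longleftrightarrow> - e \<le> x + r \<and> x + r < 0"
      by (auto simp: sp_def sn_def)
    show ?thesis
      unfolding scad_limit_density_def D_def z lp ln
      using sp sn by (simp add: c_def ou_def zero_ereal_def add.commute[of x e])
  qed
  \<comment> \<open>Nonnegativity allows \<open>ennreal\<close> of the sum in \<open>dens\<close> to
    be split into summands.\<close>
  have D_nonneg: "D k t I x \<ge> 0" if "k > 0" for k t I x
    using that by (simp add: D_def)
  \<comment> \<open>On \<open>ce\<close> the map is constantly \<open>- r\<close>, so the indicator
    of \<open>A\<close> factors out and the normal mass of \<open>ce\<close> remains.\<close>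
  have atom: "(\<integral>\<^sup>+z. J ce (\<lambda>_. - r) z \<partial>lborel)
      = ennreal (std_normal_cdf (- ereal r + ereal e) - std_normal_cdf (- ereal r - ereal e))
        * indicator A (- r)"
  proof -
    have "(\<integral>\<^sup>+z. J ce (\<lambda>_. - r) z \<partial>lborel) = emeasure std_normal_distribution ce * indicator A (- r)"
      unfolding J_def by (simp add: nn_integral_multc emeasure_density)
    then show ?thesis
      using emeasure_std_normal_Icc[of "- r - e" "- r + e"] assms(2)
      by (simp add: ce_def std_normal_cdf_def)
  qed
  have [measurable]: "scad_limit_density a e (ereal r) \<in> borel_measurable borel"
    unfolding dens[abs_def] by measurable
  have "emeasure (distr std_normal_distribution borel ?G) A
      = (\<integral>\<^sup>+z. ennreal (std_normal_density z) * indicator A (?G z) \<partial>lborel)"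
  proof -
    have "?G -` A \<in> sets borel"
      using measurable_sets[of ?G borel borel A] by simp
    then show ?thesis
      by (simp add: emeasure_distr emeasure_density indicator_vimage)
  qed
  also have "\<dots> = (\<integral>\<^sup>+z. J ce (\<lambda>_. - r) z \<partial>lborel) + (\<integral>\<^sup>+z. J sp (\<lambda>z. z - e) z \<partial>lborel)
      + (\<integral>\<^sup>+z. J sn (\<lambda>z. z + e) z \<partial>lborel) + (\<integral>\<^sup>+z. J lp gp z \<partial>lborel)
      + (\<integral>\<^sup>+z. J ln gn z \<partial>lborel) + (\<integral>\<^sup>+z. J ou (\<lambda>z. z) z \<partial>lborel)"
    unfolding split by (simp add: nn_integral_add)
  also have "\<dots> = (\<integral>\<^sup>+z. J ce (\<lambda>_. - r) z \<partial>lborel)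
      + ((\<integral>\<^sup>+x. ennreal (D 1 e sp x) * indicator A x \<partial>lborel)
      + (\<integral>\<^sup>+x. ennreal (D 1 (- e) sn x) * indicator A x \<partial>lborel)
      + (\<integral>\<^sup>+x. ennreal (D c ((- r + a * e) / (a - 1)) lp x) * indicator A x \<partial>lborel)
      + (\<integral>\<^sup>+x. ennreal (D c ((- r - a * e) / (a - 1)) ln x) * indicator A x \<partial>lborel)
      + (\<integral>\<^sup>+x. ennreal (D 1 0 ou x) * indicator A x \<partial>lborel))"
    using affine[of sp 1 "\<lambda>z. z - e" e] affine[of sn 1 "\<lambda>z. z + e" "- e"]
      affine[OF _ \<open>c > 0\<close> tp, of lp] affine[OF _ \<open>c > 0\<close> tn, of ln] affine[of ou 1 "\<lambda>z. z" 0]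
    by (simp add: add.assoc)
  also have "\<dots> = (\<integral>\<^sup>+z. J ce (\<lambda>_. - r) z \<partial>lborel)
      + (\<integral>\<^sup>+x. ennreal (scad_limit_density a e (ereal r) x) * indicator A x \<partial>lborel)"
    unfolding dens using D_nonneg \<open>c > 0\<close>
    by (simp add: nn_integral_add[symmetric] distrib_right)
  also have "\<dots> = emeasure (scad_limit a e (ereal r)) A"
    unfolding atom scad_limit_def
    by (subst emeasure_add_measure) (auto simp: emeasure_density)
  finally show "emeasure (scad_limit a e (ereal r)) A
      = emeasure (distr std_normal_distribution borel ?G) A" by simp
qed

text \<open>Both cdf arguments are the same infinity, so the atom has coefficient 0; of the
  indicators only the outer one survives.\<close>

lemma scad_limit_infinite:
  assumes "\<bar>\<nu>\<bar> = \<infinity>"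
  shows "scad_limit a e \<nu> = std_normal_distribution"
proof (rule measure_eqI)
  have coeff: "std_normal_cdf (- \<nu> + ereal e) - std_normal_cdf (- \<nu> - ereal e) = 0"
    using assms by (cases \<nu>) (auto simp: std_normal_cdf_def)
  have dens: "scad_limit_density a e \<nu> x = std_normal_density x" for x
    using assms by (cases \<nu>) (auto simp: scad_limit_density_def)
  fix A assume "A \<in> sets (scad_limit a e \<nu>)"
  then show "emeasure (scad_limit a e \<nu>) A = emeasure std_normal_distribution A"
    unfolding scad_limit_def coeff dens by (subst emeasure_add_measure) auto
qed (simp add: scad_limit_def)

section \<open>Convergence of the rescaled maps and conclusion\<close>

text \<open>For finite \<open>\<nu>\<close> this is joint continuity. For infinite
  \<open>\<nu>\<close> the shift \<open>t n\<close> eventually drives \<open>z + t n\<close> into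
  the region where the threshold map is the identity, so the sequence is eventually
  constant.\<close>

lemma tendsto_scaled_scad_threshold:
  fixes \<nu> :: ereal
  assumes "a > 2" and "0 \<le> e" and nonneg: "\<forall>\<^sub>F n in sequentially. 0 \<le> h n"
    and h: "h \<longlonglongrightarrow> e" and t: "(\<lambda>n. ereal (t n)) \<longlonglongrightarrow> \<nu>"
  shows "(\<lambda>n. scad_threshold a (h n) (z + t n) - t n)
    \<longlonglongrightarrow> (if \<bar>\<nu>\<bar> = \<infinity> then z else scad_threshold a e (z + real_of_ereal \<nu>) - real_of_ereal \<nu>)"
proof (cases "\<bar>\<nu>\<bar> = \<infinity>")
  case False
  then obtain r where r: "\<nu> = ereal r" by (cases \<nu>) auto
  with t have "t \<longlonglongrightarrow> r" by simp
  then show ?thesis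
    unfolding r using assms by (auto intro!: tendsto_diff tendsto_scad_threshold tendsto_intros)
next
  case True
  \<comment> \<open>Eventually \<open>h n < e + 1\<close>, so \<open>a * (e + 1)\<close> bounds the
    outer breakpoint \<open>a * h n\<close>; the extra \<open>\<bar>z\<bar>\<close> pays for the
    triangle inequality.\<close>
  have "\<forall>\<^sub>F n in sequentially. \<bar>t n\<bar> > \<bar>z\<bar> + a * (e + 1)"
  proof (cases \<nu>)
    case PInf
    then have "\<forall>\<^sub>F n in sequentially. t n > \<bar>z\<bar> + a * (e + 1)"
      using t by (simp add: tendsto_PInfty)
    then show ?thesis by eventually_elim linarith
  next
    case MInf
    then have "\<forall>\<^sub>F n in sequentially. t n < - (\<bar>z\<bar> + a * (e + 1))"
      using t by (simp add: tendsto_MInfty)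
    then show ?thesis by eventually_elim linarith
  qed (use True in auto)
  moreover have "\<forall>\<^sub>F n in sequentially. h n < e + 1"
    using h by (rule order_tendstoD) simp
  ultimately have "\<forall>\<^sub>F n in sequentially. scad_threshold a (h n) (z + t n) - t n = z"
    using nonneg
  proof eventually_elim
    case (elim n)
    have "a * h n \<le> a * (e + 1)"
      using elim \<open>a > 2\<close> by (intro mult_left_mono) auto
    then have "\<bar>z + t n\<bar> > a * h n"
      using elim by linarith
    then show ?case
      using elim \<open>a > 2\<close> by (simp add: scad_threshold_large)
  qed
  then show ?thesis
    using True by (simp add: tendsto_eventually)
qed

theorem theorem6:
  fixes a e :: real and \<eta> \<theta> :: "nat \<Rightarrow> real" and \<nu> :: ereal
  assumes "a > 2"
    and "\<And>n. n \<ge> 1 \<Longrightarrow> \<eta> n > 0"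
    and "\<eta> \<longlonglongrightarrow> 0"
    and "0 \<le> e"
    and "(\<lambda>n. sqrt (real n) * \<eta> n) \<longlonglongrightarrow> e"
    and "(\<lambda>n. ereal (sqrt (real n) * \<theta> n)) \<longlonglongrightarrow> \<nu>"
  shows "real_distribution (scad_limit a e \<nu>)
    \<and> weak_conv_m (\<lambda>n. scad_distribution a (\<eta> n) n (\<theta> n)) (scad_limit a e \<nu>)
    \<and> (\<bar>\<nu>\<bar> = \<infinity> \<or> e = 0 \<longrightarrow> scad_limit a e \<nu> = std_normal_distribution)"
proof -
  interpret N: real_distribution std_normal_distribution by (rule real_dist_normal_dist)
  define G where "G = (\<lambda>z. if \<bar>\<nu>\<bar> = \<infinity> then z
    else scad_threshold a e (z + real_of_ereal \<nu>) - real_of_ereal \<nu>)"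
  define X where "X n z = scad_threshold a (sqrt (real n) * \<eta> n) (z + sqrt (real n) * \<theta> n)
    - sqrt (real n) * \<theta> n" for n z
  have [measurable]: "G \<in> borel_measurable borel" "X n \<in> borel_measurable borel" for n
    unfolding G_def X_def[abs_def] by measurable
  have id: "distr std_normal_distribution borel (\<lambda>z. z) = std_normal_distribution"
    by (rule distr_id2) simp
  have limit: "scad_limit a e \<nu> = distr std_normal_distribution borel G"
  proof (cases "\<bar>\<nu>\<bar> = \<infinity>")
    case True
    then show ?thesis by (simp add: G_def scad_limit_infinite id)
  next
    case False
    then obtain r where "\<nu> = ereal r" by (cases \<nu>) auto
    then show ?thesis using scad_limit_eq_distr[OF assms(1,4), of r] by (simp add: G_def)
  qed
  have "\<forall>\<^sub>F n in sequentially. 0 \<le> sqrt (real n) * \<eta> n"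
    using eventually_ge_at_top[of 1] by eventually_elim (simp add: assms(2) less_imp_le)
  then have "(\<lambda>n. X n z) \<longlonglongrightarrow> G z" for z
    unfolding X_def G_def by (intro tendsto_scaled_scad_threshold assms)
  then have "weak_conv_m (\<lambda>n. distr std_normal_distribution borel (X n)) (scad_limit a e \<nu>)"
    unfolding limit by (intro weak_conv_m_distr_pointwise N.prob_space_axioms) auto
  \<comment> \<open>The two laws are identified for \<open>n \<ge> 1\<close> only, which suffices
    for the limit of the cdfs.\<close>
  moreover have "\<forall>\<^sub>F n in sequentially.
      distr std_normal_distribution borel (X n) = scad_distribution a (\<eta> n) n (\<theta> n)"
    using eventually_ge_at_top[of 1]
    by eventually_elim (simp add: scad_distribution_eq_distr_std_normal X_def[abs_def])
  then have "\<forall>\<^sub>F n in sequentially. cdf (distr std_normal_distribution borel (X n)) x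
      = cdf (scad_distribution a (\<eta> n) n (\<theta> n)) x" for x
    by eventually_elim simp
  ultimately have "weak_conv_m (\<lambda>n. scad_distribution a (\<eta> n) n (\<theta> n)) (scad_limit a e \<nu>)"
    unfolding weak_conv_m_def weak_conv_def by (auto intro: Lim_transform_eventually)
  \<comment> \<open>For \<open>e = 0\<close> the threshold map is the identity and the shifts by
    \<open>\<nu>\<close> cancel.\<close>
  moreover have "G = (\<lambda>z. z)" if "\<bar>\<nu>\<bar> = \<infinity> \<or> e = 0"
    using that by (auto simp: G_def)
  \<comment> \<open>\<open>weak_conv_m\<close> compares cdfs and does not by itself make the limit a
    probability measure; that follows from \<open>limit\<close>, which presents it as the law of the
    measurable map \<open>G\<close>.\<close>
  ultimately show ?thesis
    using id by (auto simp: limit)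
qed

end
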